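(* Let $\rho\in[0,1)$ and let $n$ be a positive integer. The density $\nu(\rho,n,z)$ has the following properties: (i) $\nu(\rho,n,z)=\nu(\rho,n,-z)=\nu(1-\rho,n,z)$; (ii) the support of $\nu(\rho,n,z)$, as a function of $z$, is symmetric (about $0$); (iii) $0\le\nu(\rho,n,z)\le1$.
   Context: $\{t\}=t-\lfloor t\rfloor$ denotes the fractional part. For $\rho\in\mathbb{R}$, a positive integer $n$, and $x\in[0,1)$, $S(\rho,n,x)=\sum_{i=1}^{n}\left(\{x+i\rho\}-\tfrac12\right)$; as a function of $x$ it is piecewise affine with slope $n$. The Birkhoff density is $\nu(\rho,n,z)=\sum_{x:\,S(\rho,n,x)=z}\frac{1}{|\partial_xS(\rho,n,x)|}$, equivalently $\nu(\rho,n,z)=\frac1n\,\#\{x\in[0,1): S(\rho,n,x)=z\}$, for $z\in\mathbb{R}$; it is the density of the pushforward of Lebesgue measure on $[0,1)$ under $x\mapsto S(\rho,n,x)$. The support of $\nu(\rho,n,\cdot)$ is the set of $z$ where it is nonzero, i.e. the range of $x\mapsto S(\rho,n,x)$.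
   Formalization: ν(z)=ν(−z) and symmetry of the support are proved where no preimage of z or −z is a jump of S (all but finitely many z), and the closure of the support is exactly symmetric; pointwise both fail, e.g. ρ=0, n=1, z=−1/2. *)

theory Defs
  imports "HOL-Analysis.Analysis"
begin

(* The formula is used for every real x, i.e. the sum is extended 1-periodically from [0,1).
   So differentiability at x = 0 below is two-sided, as on the circle. *)
definition birkhoff_sum :: "real \<Rightarrow> nat \<Rightarrow> real \<Rightarrow> real" where
  "birkhoff_sum \<rho> n x = (\<Sum>i=1..n. (frac (x + real i * \<rho>) - 1/2))"

definition birkhoff_density :: "real \<Rightarrow> nat \<Rightarrow> real \<Rightarrow> real" where
  "birkhoff_density \<rho> n z = real (card {x \<in> {0..<1}. birkhoff_sum \<rho> n x = z}) / real n"

definition birkhoff_support :: "real \<Rightarrow> nat \<Rightarrow> real set" where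
  "birkhoff_support \<rho> n = support_on UNIV (birkhoff_density \<rho> n)"

(* The z at which the sum of 1/|S'(x)| over the preimages x of z makes sense: no preimage
   is a jump point of S = birkhoff_sum \<rho> n. *)
definition regular_value :: "real \<Rightarrow> nat \<Rightarrow> real \<Rightarrow> bool" where
  "regular_value \<rho> n z \<longleftrightarrow>
    (\<forall>x\<in>{0..<1}. birkhoff_sum \<rho> n x = z \<longrightarrow> birkhoff_sum \<rho> n differentiable (at x))"

lemma birkhoff_sum_right_derivative:
  "(birkhoff_sum \<rho> n has_field_derivative real n) (at_right x)"
proof -
  have frac_deriv: "((\<lambda>y::real. frac (y + c) - 1/2) has_field_derivative 1) (at_right x)" for c
  proof -
    define d where "d = 1 - frac (x + c)"
    have d: "d > 0" by (simp add: d_def frac_lt_1)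
    have eq: "frac (y + c) = y + c - of_int \<lfloor>x + c\<rfloor>" if "x \<le> y" "y < x + d" for y
    proof -
      have "\<lfloor>y + c\<rfloor> = \<lfloor>x + c\<rfloor>"
        using that by (intro floor_unique) (auto simp: d_def frac_def le_floor_iff algebra_simps, linarith+)
      then show ?thesis by (simp add: frac_def)
    qed
    have "((\<lambda>y::real. y + c - of_int \<lfloor>x + c\<rfloor> - 1/2) has_field_derivative 1) (at x within {x..})"
      by (auto intro!: derivative_eq_intros)
    then have "((\<lambda>y::real. frac (y + c) - 1/2) has_field_derivative 1) (at x within {x..})"
      by (rule has_field_derivative_transform_within[OF _ d]) (auto simp: eq dist_real_def)
    then show ?thesis
      by (rule DERIV_subset) auto
  qed
  have "((\<lambda>y. \<Sum>i=1..n. frac (y + real i * \<rho>) - 1/2) has_field_derivative (\<Sum>i=1..n. 1)) (at_right x)"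
    by (intro DERIV_sum frac_deriv)
  then show ?thesis by (simp add: birkhoff_sum_def[abs_def])
qed

lemma deriv_birkhoff_sum:
  assumes "birkhoff_sum \<rho> n differentiable (at x)"
  shows "deriv (birkhoff_sum \<rho> n) x = real n"
proof -
  have "(birkhoff_sum \<rho> n has_field_derivative deriv (birkhoff_sum \<rho> n) x) (at x)"
    using assms by (simp add: DERIV_deriv_iff_real_differentiable)
  then have "(birkhoff_sum \<rho> n has_field_derivative deriv (birkhoff_sum \<rho> n) x) (at_right x)"
    by (rule has_field_derivative_at_within)
  then show ?thesis
    using birkhoff_sum_right_derivative[of \<rho> n x] unfolding has_field_derivative_iff
    by (blast intro: tendsto_unique[OF trivial_limit_at_right_real])
qed

lemma birkhoff_density_eq_sum_deriv:
  assumes "regular_value \<rho> n z"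
  shows "birkhoff_density \<rho> n z =
    (\<Sum>x\<in>{x \<in> {0..<1}. birkhoff_sum \<rho> n x = z}. 1 / \<bar>deriv (birkhoff_sum \<rho> n) x\<bar>)"
proof -
  have "(\<Sum>x\<in>{x \<in> {0..<1}. birkhoff_sum \<rho> n x = z}. 1 / \<bar>deriv (birkhoff_sum \<rho> n) x\<bar>)
      = (\<Sum>x\<in>{x \<in> {0..<1}. birkhoff_sum \<rho> n x = z}. 1 / real n)"
    using assms by (intro sum.cong) (auto simp: regular_value_def deriv_birkhoff_sum)
  then show ?thesis by (simp add: birkhoff_density_def)
qed

(* The reflection symmetry cannot hold at every z: the fractional part is only
   right-continuous, so the range of birkhoff_sum consists of half-open intervals. *)
lemma reflection_fails_at_endpoint:
  "birkhoff_density 0 1 (-1/2) = 1" "birkhoff_density 0 1 (1/2) = 0"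
proof -
  have S01: "birkhoff_sum 0 (Suc 0) x = x - 1/2" if "x \<in> {0..<1}" for x
    using that by (simp add: birkhoff_sum_def frac_eq)
  have "{x \<in> {0..<1}. birkhoff_sum 0 1 x = -1/2} = {0::real}"
    by (auto simp: S01)
  then show "birkhoff_density 0 1 (-1/2) = 1"
    by (simp add: birkhoff_density_def)
  have "{x \<in> {0..<1}. birkhoff_sum 0 (Suc 0) x = 1/2} = ({}::real set)"
    by (auto simp: S01)
  then show "birkhoff_density 0 1 (1/2) = 0"
    unfolding birkhoff_density_def by (simp only: card.empty One_nat_def of_nat_0 div_0)
qed

end

theory Submission
  imports Defs
begin

text \<open>
  Put $S_\rho(x) = \sum_{i=1}^n (\{x + i\rho\} - 1/2)$. Reversing the order of summation gives
  $S_{1-\rho}(x) = S_\rho(x - (n+1)\rho)$, so the two densities agree at every $z$. Since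
  $\{t\} + \{-t\}$ is $1$ off the integers and $0$ on them, $S_\rho(x) + S_{1-\rho}(-x) = -J(x)$, where
  $J(x)$ is the number of jumps of $S_\rho$ at $x$. Hence off the jump points the involution
  $x \mapsto -x - (n+1)\rho$ of the circle negates $S_\rho$. Jump points are isolated and $S_\rho$ is
  right-continuous, so they do not matter for the closure of the range. Finally, $S_\rho(x) = z$
  makes $nx$ differ from a constant by an integer, which leaves at most $n$ points $x$ in $[0,1)$.
\<close>

text \<open>The indices whose summand drops by 1 at \<open>x\<close>. A set of indices rather than
  of points, since several summands may jump at one point; its cardinality is the J(x)
  above.\<close>

definition jump_index :: "real \<Rightarrow> nat \<Rightarrow> real \<Rightarrow> nat set" where
  "jump_index \<rho> n x = {i \<in> {1..n}. x + real i * \<rho> \<in> \<int>}"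

lemma finite_jump_index [simp]: "finite (jump_index \<rho> n x)"
  by (simp add: jump_index_def)

section \<open>Periodicity, rotation and reflection of the Birkhoff sum\<close>

lemma birkhoff_sum_add_Ints:
  assumes "m \<in> \<int>"
  shows "birkhoff_sum \<rho> n (x + m) = birkhoff_sum \<rho> n x"
proof -
  have "frac (x + m + real i * \<rho>) = frac (x + real i * \<rho>)" for i
    using frac_add_int_right[OF assms, of "x + real i * \<rho>"] by (simp add: add_ac)
  then show ?thesis by (simp add: birkhoff_sum_def)
qed

lemma birkhoff_sum_frac [simp]: "birkhoff_sum \<rho> n (frac x) = birkhoff_sum \<rho> n x"
  by (simp add: birkhoff_sum_def)

lemma birkhoff_sum_one_minus:
  "birkhoff_sum (1 - \<rho>) n x = (\<Sum>i=1..n. (frac (x - real i * \<rho>) - 1/2))"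
proof -
  have "frac (x + real i * (1 - \<rho>)) = frac (x - real i * \<rho>)" for i
    using frac_add_int_right[of "real i" "x - real i * \<rho>"] by (simp add: algebra_simps)
  then show ?thesis by (simp add: birkhoff_sum_def)
qed

lemma birkhoff_sum_one_minus_shift:
  "birkhoff_sum (1 - \<rho>) n x = birkhoff_sum \<rho> n (x - (real n + 1) * \<rho>)"
  unfolding birkhoff_sum_one_minus unfolding birkhoff_sum_def
  by (rule sum.reindex_bij_witness[of _ "\<lambda>i. n + 1 - i" "\<lambda>i. n + 1 - i"])
     (auto simp: of_nat_diff algebra_simps)

lemma birkhoff_sum_plus_one_minus:
  "birkhoff_sum \<rho> n x + birkhoff_sum (1 - \<rho>) n (- x) = - real (card (jump_index \<rho> n x))"
proof -
  have "birkhoff_sum \<rho> n x + birkhoff_sum (1 - \<rho>) n (- x)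
      = (\<Sum>i=1..n. frac (x + real i * \<rho>) + frac (- (x + real i * \<rho>)) - 1)"
    unfolding birkhoff_sum_one_minus unfolding birkhoff_sum_def
    by (simp add: algebra_simps flip: sum.distrib)
  also have "\<dots> = (\<Sum>i=1..n. if x + real i * \<rho> \<in> \<int> then - 1 else 0)"
    by (intro sum.cong refl, subst frac_neg) simp
  also have "\<dots> = - real (card (jump_index \<rho> n x))"
    by (simp add: jump_index_def sum.If_cases Int_def)
  finally show ?thesis .
qed

text \<open>Negation followed by the rotation that turns \<open>birkhoff_sum (1 - \<rho>) n\<close>
  back into \<open>birkhoff_sum \<rho> n\<close>. The \<open>frac\<close> picks the representative
  in [0,1), where the density counts its points.\<close>

definition circle_reflection :: "real \<Rightarrow> nat \<Rightarrow> real \<Rightarrow> real" where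
  "circle_reflection \<rho> n x = frac (- x - (real n + 1) * \<rho>)"

lemma circle_reflection_in: "circle_reflection \<rho> n x \<in> {0..<1}"
  by (simp add: circle_reflection_def frac_lt_1)

lemma circle_reflection_involution:
  assumes "x \<in> {0..<1}"
  shows "circle_reflection \<rho> n (circle_reflection \<rho> n x) = x"
proof -
  have "circle_reflection \<rho> n (circle_reflection \<rho> n x)
      = frac (- (real n + 1) * \<rho> - frac (- x - (real n + 1) * \<rho>))"
    unfolding circle_reflection_def by (rule arg_cong[of _ _ frac]) (simp add: algebra_simps)
  also have "\<dots> = frac x"
    unfolding frac_diff_simp by (rule arg_cong[of _ _ frac]) (simp add: algebra_simps)
  finally show ?thesis using assms by simp
qed

lemma birkhoff_sum_circle_reflection:
  assumes "jump_index \<rho> n x = {}"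
  shows "birkhoff_sum \<rho> n (circle_reflection \<rho> n x) = - birkhoff_sum \<rho> n x"
  using birkhoff_sum_plus_one_minus[of \<rho> n x] assms
  by (simp add: circle_reflection_def birkhoff_sum_one_minus_shift)

section \<open>Jump points and regular values\<close>

lemma eventually_jump_index_empty: "eventually (\<lambda>y. jump_index \<rho> n y = {}) (at x)"
proof -
  have *: "eventually (\<lambda>y. y + c \<notin> \<int>) (at x)" for c
  proof -
    \<comment> \<open>Deleting \<open>x + c\<close> from the integers keeps this set a neighbourhood
      of \<open>x + c\<close> even if \<open>x + c\<close> is an integer; the case
      \<open>y + c = x + c\<close> is excluded by \<open>y \<noteq> x\<close>.\<close>
    have "open (- (\<int> - {x + c}))"
      by (intro open_Compl closed_subset_Ints) auto
    moreover have "((\<lambda>y. y + c) \<longlongrightarrow> x + c) (at x)"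
      by (intro tendsto_intros)
    ultimately have "eventually (\<lambda>y. y + c \<in> - (\<int> - {x + c})) (at x)"
      by (intro topological_tendstoD) auto
    with eventually_neq_at_within[of x x UNIV] show ?thesis
      by eventually_elim auto
  qed
  have "eventually (\<lambda>y. \<forall>i\<in>{1..n}. y + real i * \<rho> \<notin> \<int>) (at x)"
    using * by (intro eventually_ball_finite) auto
  then show ?thesis
    by eventually_elim (auto simp: jump_index_def)
qed

lemma birkhoff_sum_tendsto_right:
  "(birkhoff_sum \<rho> n \<longlongrightarrow> birkhoff_sum \<rho> n x) (at_right x)"
  using DERIV_continuous[OF birkhoff_sum_right_derivative] by (simp add: continuous_within)

text \<open>If S is continuous from the left at x, then so is -J, by the reflection identity. But J
  vanishes at all points close to x on its left, so J(x) = 0. Conversely, off the integers each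
  floor is locally constant, so each summand has derivative 1.\<close>

lemma birkhoff_sum_differentiable_iff:
  "birkhoff_sum \<rho> n differentiable (at x) \<longleftrightarrow> jump_index \<rho> n x = {}"
proof
  assume "birkhoff_sum \<rho> n differentiable (at x)"
  then have "(birkhoff_sum \<rho> n \<longlongrightarrow> birkhoff_sum \<rho> n x) (at x)"
    using differentiable_imp_continuous_within isContD by blast
  then have 1: "(birkhoff_sum \<rho> n \<longlongrightarrow> birkhoff_sum \<rho> n x) (at_left x)"
    by (simp add: filterlim_at_split)
  \<comment> \<open>Negating the argument turns right-continuity into left-continuity.\<close>
  have 2: "((\<lambda>y. birkhoff_sum (1 - \<rho>) n (- y)) \<longlongrightarrow> birkhoff_sum (1 - \<rho>) n (- x)) (at_left x)"
    unfolding filterlim_at_left_to_right using birkhoff_sum_tendsto_right by simp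
  have "((\<lambda>y. - real (card (jump_index \<rho> n y))) \<longlongrightarrow> - real (card (jump_index \<rho> n x))) (at_left x)"
    using tendsto_add[OF 1 2] by (simp add: birkhoff_sum_plus_one_minus)
  moreover have "((\<lambda>y. - real (card (jump_index \<rho> n y))) \<longlongrightarrow> 0) (at_left x)"
  proof (rule tendsto_eventually)
    have "eventually (\<lambda>y. jump_index \<rho> n y = {}) (at_left x)"
      using eventually_jump_index_empty by (simp add: eventually_at_split)
    then show "eventually (\<lambda>y. - real (card (jump_index \<rho> n y)) = 0) (at_left x)"
      by eventually_elim simp
  qed
  ultimately have "- real (card (jump_index \<rho> n x)) = 0"
    by (rule tendsto_unique[OF trivial_limit_at_left_real])
  then show "jump_index \<rho> n x = {}" by simp
next
  assume "jump_index \<rho> n x = {}"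
  then have "((\<lambda>y. frac (y + real i * \<rho>) - 1/2) has_real_derivative 1) (at x)" if "i \<in> {1..n}" for i
    using that unfolding frac_def jump_index_def
    by (auto intro!: derivative_eq_intros floor_has_real_derivative)
  then have "((\<lambda>y. \<Sum>i=1..n. frac (y + real i * \<rho>) - 1/2) has_real_derivative (\<Sum>i=1..n. 1)) (at x)"
    by (intro DERIV_sum)
  then show "birkhoff_sum \<rho> n differentiable (at x)"
    unfolding birkhoff_sum_def[abs_def] real_differentiable_def by blast
qed

text \<open>A value that is not regular is taken at a jump point, and modulo 1 the jump points are
  the \<open>- real i * \<rho>\<close> with \<open>i \<in> {1..n}\<close>.\<close>

lemma finite_not_regular_value: "finite {z. \<not> regular_value \<rho> n z}"
proof (rule finite_subset)
  show "{z. \<not> regular_value \<rho> n z} \<subseteq> (\<lambda>i. birkhoff_sum \<rho> n (frac (- real i * \<rho>))) ` {1..n}"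
  proof
    fix z assume "z \<in> {z. \<not> regular_value \<rho> n z}"
    then obtain x i where x: "x \<in> {0..<1}" "z = birkhoff_sum \<rho> n x"
      and i: "i \<in> {1..n}" "x + real i * \<rho> \<in> \<int>"
      by (auto simp: regular_value_def birkhoff_sum_differentiable_iff jump_index_def)
    have "birkhoff_sum \<rho> n (- real i * \<rho>) = birkhoff_sum \<rho> n x"
      using birkhoff_sum_add_Ints[OF i(2), of \<rho> n "- real i * \<rho>"] by simp
    then show "z \<in> (\<lambda>i. birkhoff_sum \<rho> n (frac (- real i * \<rho>))) ` {1..n}"
      using x(2) i(1) by (intro image_eqI[of _ _ i]) simp_all
  qed
qed simp

section \<open>Size of the fibres\<close>

lemma birkhoff_fibre_card:
  assumes "n > 0"
  shows "finite {x \<in> {0..<1}. birkhoff_sum \<rho> n x = z}"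
    and "card {x \<in> {0..<1}. birkhoff_sum \<rho> n x = z} \<le> n"
proof -
  \<comment> \<open>With each fractional part written as t minus its floor, S(x) = z says that the
    integer \<open>k x\<close> equals \<open>real n * x + c\<close>; so \<open>k x\<close>
    determines x.\<close>
  define c where "c = (\<Sum>i=1..n. real i * \<rho> - 1/2) - z"
  define k where "k x = (\<Sum>i=1..n. \<lfloor>x + real i * \<rho>\<rfloor>)" for x
  let ?F = "{x \<in> {0..<1}. birkhoff_sum \<rho> n x = z}"
  have k: "of_int (k x) = real n * x + c" if "x \<in> ?F" for x
    using that by (auto simp: k_def c_def birkhoff_sum_def frac_def sum.distrib sum_subtractf)
  have inj: "inj_on k ?F"
  proof (rule inj_onI)
    fix x y assume "x \<in> ?F" "y \<in> ?F" "k x = k y"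
    then have "real n * x + c = real n * y + c" by (metis k)
    then show "x = y" using assms by simp
  qed
  \<comment> \<open>For x in [0,1) the value \<open>k x\<close> lies in the half-open interval [c, c
    + n), which contains exactly n integers.\<close>
  have range: "k ` ?F \<subseteq> {\<lceil>c\<rceil>..<\<lceil>c\<rceil> + int n}"
  proof (rule image_subsetI)
    fix x assume x: "x \<in> ?F"
    then have "0 \<le> real n * x" "real n * x < real n" using assms by auto
    with k[OF x] have "c \<le> of_int (k x)" "of_int (k x) < c + real n" by auto
    then show "k x \<in> {\<lceil>c\<rceil>..<\<lceil>c\<rceil> + int n}"
      by (simp add: ceiling_le_iff) linarith
  qed
  show "finite ?F"
    using inj range by (rule inj_on_finite) simp
  show "card ?F \<le> n"
    using card_inj_on_le[OF inj range] by simp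
qed

section \<open>Symmetries of the density\<close>

lemma birkhoff_density_one_minus: "birkhoff_density (1 - \<rho>) n z = birkhoff_density \<rho> n z"
proof -
  let ?a = "(real n + 1) * \<rho>"
  \<comment> \<open>The rotation identity holds at jump points too, so the fibres correspond for
    every z.\<close>
  have "bij_betw (\<lambda>x. frac (x - ?a)) {x \<in> {0..<1}. birkhoff_sum (1 - \<rho>) n x = z}
          {x \<in> {0..<1}. birkhoff_sum \<rho> n x = z}"
  proof (rule bij_betw_byWitness[where f' = "\<lambda>x. frac (x + ?a)"])
    have "frac (frac (x + ?a) - ?a) = frac x" "frac (frac (x - ?a) + ?a) = frac x" for x
      using frac_add_simps(1)[of "x + ?a" "- ?a"] by simp_all
    then show "\<forall>x\<in>{x \<in> {0..<1}. birkhoff_sum (1 - \<rho>) n x = z}. frac (frac (x - ?a) + ?a) = x"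
      and "\<forall>x\<in>{x \<in> {0..<1}. birkhoff_sum \<rho> n x = z}. frac (frac (x + ?a) - ?a) = x"
      by auto
    have "birkhoff_sum (1 - \<rho>) n (x + ?a) = birkhoff_sum \<rho> n x" for x
      by (simp add: birkhoff_sum_one_minus_shift)
    then show "(\<lambda>x. frac (x + ?a)) ` {x \<in> {0..<1}. birkhoff_sum \<rho> n x = z}
        \<subseteq> {x \<in> {0..<1}. birkhoff_sum (1 - \<rho>) n x = z}"
      by (auto simp: frac_lt_1)
    show "(\<lambda>x. frac (x - ?a)) ` {x \<in> {0..<1}. birkhoff_sum (1 - \<rho>) n x = z}
        \<subseteq> {x \<in> {0..<1}. birkhoff_sum \<rho> n x = z}"
      by (auto simp: birkhoff_sum_one_minus_shift frac_lt_1)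
  qed
  then show ?thesis
    by (simp add: birkhoff_density_def bij_betw_same_card)
qed

text \<open>The reflection negates S only off the jump points. Regularity of z sends its fibre into
  that of -z, and regularity of -z gives the way back.\<close>

lemma birkhoff_density_uminus:
  assumes "regular_value \<rho> n z" "regular_value \<rho> n (- z)"
  shows "birkhoff_density \<rho> n (- z) = birkhoff_density \<rho> n z"
proof -
  have S: "birkhoff_sum \<rho> n (circle_reflection \<rho> n x) = - w"
    if "regular_value \<rho> n w" "x \<in> {0..<1}" "birkhoff_sum \<rho> n x = w" for w x
    using that birkhoff_sum_circle_reflection
    by (auto simp: regular_value_def birkhoff_sum_differentiable_iff)
  have "bij_betw (circle_reflection \<rho> n) {x \<in> {0..<1}. birkhoff_sum \<rho> n x = - z}
          {x \<in> {0..<1}. birkhoff_sum \<rho> n x = z}"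
    using S[OF assms(1)] S[OF assms(2)] circle_reflection_in circle_reflection_involution
    by (intro bij_betw_byWitness[where f' = "circle_reflection \<rho> n"]) auto
  then show ?thesis
    by (simp add: birkhoff_density_def bij_betw_same_card)
qed

section \<open>The support and its closure\<close>

lemma birkhoff_support_eq_range:
  assumes "n > 0"
  shows "birkhoff_support \<rho> n = range (birkhoff_sum \<rho> n)"
proof -
  \<comment> \<open>Since \<open>card\<close> is 0 on infinite sets, finiteness of the fibre is what
    makes nonzero density the same as a nonempty fibre.\<close>
  have "z \<in> birkhoff_support \<rho> n \<longleftrightarrow> (\<exists>x\<in>{0..<1}. birkhoff_sum \<rho> n x = z)" for z
    using assms birkhoff_fibre_card(1)[OF assms, of \<rho> z]
    by (auto simp: birkhoff_support_def in_support_on birkhoff_density_def)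
  moreover have "(\<exists>x\<in>{0..<1}. birkhoff_sum \<rho> n x = z) \<longleftrightarrow> z \<in> range (birkhoff_sum \<rho> n)" for z
  proof
    assume "z \<in> range (birkhoff_sum \<rho> n)"
    then obtain x where "z = birkhoff_sum \<rho> n (frac x)" by auto
    then show "\<exists>x\<in>{0..<1}. birkhoff_sum \<rho> n x = z"
      by (intro bexI[of _ "frac x"]) (auto simp: frac_lt_1)
  qed auto
  ultimately show ?thesis by blast
qed

text \<open>Every value S(x), even at a jump point, is a limit from the right of values S(y) at
  points without jumps, and -S(y) is again a value of S. The closure absorbs the missing endpoints
  of the half-open intervals that form the range.\<close>

lemma closure_range_birkhoff_sum_uminus:
  "uminus ` closure (range (birkhoff_sum \<rho> n)) = closure (range (birkhoff_sum \<rho> n))"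
proof -
  let ?R = "range (birkhoff_sum \<rho> n)"
  have neg: "uminus ` closure ?R = closure (uminus ` ?R)"
    using closure_scaleR[of "- 1" ?R] by simp
  have "birkhoff_sum \<rho> n x \<in> closure (uminus ` ?R)" for x
  proof (rule Lim_in_closed_set[OF closed_closure])
    have "eventually (\<lambda>y. jump_index \<rho> n y = {}) (at_right x)"
      using eventually_jump_index_empty by (simp add: eventually_at_split)
    then show "eventually (\<lambda>y. birkhoff_sum \<rho> n y \<in> closure (uminus ` ?R)) (at_right x)"
    proof eventually_elim
      case (elim y)
      then have "birkhoff_sum \<rho> n y = - birkhoff_sum \<rho> n (circle_reflection \<rho> n y)"
        by (simp add: birkhoff_sum_circle_reflection)
      then have "birkhoff_sum \<rho> n y \<in> uminus ` ?R" by simp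
      then show ?case by (rule subsetD[OF closure_subset])
    qed
  qed (simp_all add: birkhoff_sum_tendsto_right)
  then have sub: "closure ?R \<subseteq> uminus ` closure ?R"
    unfolding neg by (intro closure_minimal) auto
  \<comment> \<open>Negation is an involution, so the other inclusion is the image of the first
    one.\<close>
  then have "uminus ` closure ?R \<subseteq> uminus ` uminus ` closure ?R"
    by (rule image_mono)
  then have "uminus ` closure ?R \<subseteq> closure ?R"
    by (simp add: image_image)
  with sub show ?thesis by blast
qed

theorem proposition2p1:
  fixes \<rho> :: real and n :: nat
  assumes "0 \<le> \<rho>" and "\<rho> < 1" and "n > 0"
  shows "finite {z. \<not> regular_value \<rho> n z} \<and>
    (\<forall>z. regular_value \<rho> n z \<and> regular_value \<rho> n (- z) \<longrightarrow>
           birkhoff_density \<rho> n z = birkhoff_density \<rho> n (- z)) \<and>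
    (\<forall>z. birkhoff_density \<rho> n z = birkhoff_density (1 - \<rho>) n z) \<and>
    uminus ` closure (birkhoff_support \<rho> n) = closure (birkhoff_support \<rho> n) \<and>
    (\<forall>z. regular_value \<rho> n z \<and> regular_value \<rho> n (- z) \<longrightarrow>
           (z \<in> birkhoff_support \<rho> n \<longleftrightarrow> - z \<in> birkhoff_support \<rho> n)) \<and>
    (\<forall>z. 0 \<le> birkhoff_density \<rho> n z \<and> birkhoff_density \<rho> n z \<le> 1)"
proof (intro conjI allI impI)
  show "finite {z. \<not> regular_value \<rho> n z}"
    by (rule finite_not_regular_value)
next
  fix z assume "regular_value \<rho> n z \<and> regular_value \<rho> n (- z)"
  then have eq: "birkhoff_density \<rho> n (- z) = birkhoff_density \<rho> n z"
    using birkhoff_density_uminus by blast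
  then show "birkhoff_density \<rho> n z = birkhoff_density \<rho> n (- z)" by simp
  show "z \<in> birkhoff_support \<rho> n \<longleftrightarrow> - z \<in> birkhoff_support \<rho> n"
    using eq by (simp add: birkhoff_support_def in_support_on)
next
  fix z
  show "birkhoff_density \<rho> n z = birkhoff_density (1 - \<rho>) n z"
    by (simp add: birkhoff_density_one_minus)
next
  show "uminus ` closure (birkhoff_support \<rho> n) = closure (birkhoff_support \<rho> n)"
    using assms(3) by (simp only: birkhoff_support_eq_range closure_range_birkhoff_sum_uminus)
next
  fix z
  show "0 \<le> birkhoff_density \<rho> n z"
    by (simp add: birkhoff_density_def)
  show "birkhoff_density \<rho> n z \<le> 1"
    \<comment> \<open>At most n preimages, each of weight 1/n.\<close>
    using birkhoff_fibre_card(2)[OF assms(3), of \<rho> z] assms(3)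
    by (simp add: birkhoff_density_def)
qed

end
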